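(* Let $\mathbf{M}=\begin{bmatrix} M_{11} & M_{12}\\ M_{12}^* & M_{22}\end{bmatrix}$ be a complex positive semidefinite matrix in which each block $M_{11}, M_{12}, M_{22}$ is $2\times 2$. If $\mathbf{M}$ has $\mathfrak{la}$-property, then $\mathbf{M}$ has $\mathfrak{a}$-property or $\mathbf{M}$ has $\mathfrak{lg}$-property.
   Context: All matrices have complex entries. For an $n\times n$ matrix $A$, $s_1(A)\ge s_2(A)\ge\cdots\ge s_n(A)$ denote its singular values in nonincreasing order; if $A$ is Hermitian, $\lambda_1(A)\ge\lambda_2(A)\ge\cdots\ge\lambda_n(A)$ denote its eigenvalues in nonincreasing order. For $n\times n$ positive definite $A,B$, the geometric mean is $A\sharp B=B^{1/2}(B^{-1/2}AB^{-1/2})^{1/2}B^{1/2}$; for positive semidefinite $A,B$ it is defined by $A\sharp B=\lim_{\epsilon\to0^+}(A+\epsilon I_n)\sharp(B+\epsilon I_n)$, where $I_n$ is the $n\times n$ identity matrix. For a positive semidefinite matrix $\mathbf{M}=\begin{bmatrix} M_{11} & M_{12}\\ M_{12}^* & M_{22}\end{bmatrix}$ with all blocks $n\times n$ (here $n=2$): (i) $\mathbf{M}$ has $\mathfrak{la}$-property if $\prod_{j=1}^k 2s_j(M_{12})\le\prod_{j=1}^k\lambda_j(M_{11}+M_{22})$ for all $k=1,\ldots,n$. (ii) $\mathbf{M}$ has $\mathfrak{lg}$-property if $\prod_{j=1}^k s_j(M_{12})\le\prod_{j=1}^k\lambda_j(M_{11}\sharp M_{22})$ for all $k=1,\ldots,n$.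 (iii) $\mathbf{M}$ has $\mathfrak{a}$-property if $2s_j(M_{12})\le\lambda_j(M_{11}+M_{22})$ for all $j=1,\ldots,n$. *)

theory Defs
  imports "HOL-Analysis.Analysis" "HOL-Computational_Algebra.Computational_Algebra"
begin

definition adj :: "complex^'n^'m \<Rightarrow> complex^'m^'n" where
  "adj A = (\<chi> i j. cnj (A $ j $ i))"

definition hermitian :: "complex^'n^'n \<Rightarrow> bool" where
  "hermitian A \<longleftrightarrow> adj A = A"

definition cinner :: "complex^'n \<Rightarrow> complex^'n \<Rightarrow> complex" where
  "cinner x y = (\<Sum>i\<in>UNIV. cnj (x $ i) * y $ i)"

(* For Hermitian A the number cinner x (A *v x) is real, so taking Re loses nothing. *)
definition pos_semidef :: "complex^'n^'n \<Rightarrow> bool" where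
  "pos_semidef A \<longleftrightarrow> hermitian A \<and> (\<forall>x. 0 \<le> Re (cinner x (A *v x)))"

definition charpoly :: "complex^'n^'n \<Rightarrow> complex poly" where
  "charpoly A = det (\<chi> i j. (if i = j then [:0, 1:] else 0) - [:A $ i $ j:])"

(* eigval A j is the j-th largest eigenvalue (j = 1, ..., n), repeated according to
   multiplicity.  It is meaningful for Hermitian A, whose eigenvalues are real. *)
definition eigval :: "complex^'n^'n \<Rightarrow> nat \<Rightarrow> real" where
  "eigval A j = rev (sorted_list_of_multiset (image_mset Re (proots (charpoly A)))) ! (j - 1)"

definition singval :: "complex^'n^'n \<Rightarrow> nat \<Rightarrow> real" where
  "singval A j = sqrt (eigval (adj A ** A) j)"

(* the unique positive semidefinite square root of a positive semidefinite matrix *)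
definition mat_sqrt :: "complex^'n^'n \<Rightarrow> complex^'n^'n" where
  "mat_sqrt A = (THE S. pos_semidef S \<and> S ** S = A)"

definition geom_mean_pd :: "complex^'n^'n \<Rightarrow> complex^'n^'n \<Rightarrow> complex^'n^'n" where
  "geom_mean_pd A B =
     (let R = mat_sqrt B; Q = matrix_inv R in R ** mat_sqrt (Q ** A ** Q) ** R)"

(* On positive definite A and B this agrees with geom_mean_pd, by continuity. *)
definition geom_mean :: "complex^'n^'n \<Rightarrow> complex^'n^'n \<Rightarrow> complex^'n^'n" where
  "geom_mean A B =
     Lim (at_right 0) (\<lambda>\<epsilon>::real. geom_mean_pd (A + \<epsilon> *\<^sub>R mat 1) (B + \<epsilon> *\<^sub>R mat 1))"

(* The blocks of a 2n x 2n matrix, indexed by 'n + 'n.  The (2,1) block of a Hermitian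
   matrix is the adjoint of the (1,2) block. *)
definition block11 :: "complex^('n + 'n)^('n + 'n) \<Rightarrow> complex^'n^'n" where
  "block11 M = (\<chi> i j. M $ Inl i $ Inl j)"

definition block12 :: "complex^('n + 'n)^('n + 'n) \<Rightarrow> complex^'n^'n" where
  "block12 M = (\<chi> i j. M $ Inl i $ Inr j)"

definition block22 :: "complex^('n + 'n)^('n + 'n) \<Rightarrow> complex^'n^'n" where
  "block22 M = (\<chi> i j. M $ Inr i $ Inr j)"

definition la_property :: "complex^('n::finite + 'n)^('n + 'n) \<Rightarrow> bool" where
  "la_property M \<longleftrightarrow>
     (\<forall>k\<in>{1..CARD('n)}. (\<Prod>j=1..k. 2 * singval (block12 M) j)
        \<le> (\<Prod>j=1..k. eigval (block11 M + block22 M) j))"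

definition lg_property :: "complex^('n::finite + 'n)^('n + 'n) \<Rightarrow> bool" where
  "lg_property M \<longleftrightarrow>
     (\<forall>k\<in>{1..CARD('n)}. (\<Prod>j=1..k. singval (block12 M) j)
        \<le> (\<Prod>j=1..k. eigval (geom_mean (block11 M) (block22 M)) j))"

definition a_property :: "complex^('n::finite + 'n)^('n + 'n) \<Rightarrow> bool" where
  "a_property M \<longleftrightarrow>
     (\<forall>j\<in>{1..CARD('n)}. 2 * singval (block12 M) j \<le> eigval (block11 M + block22 M) j)"

end

theory Submission
  imports Defs
begin

text \<open>
  Write \<open>A\<close>, \<open>X\<close>, \<open>B\<close> for the blocks of \<open>M\<close>, \<open>G\<close> for the geometric mean of \<open>A\<close> and \<open>B\<close>,
  and number singular values and eigenvalues decreasingly.  Two general facts carry the proof.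

  \<^item> The determinant inequality \<open>\<bar>det X\<bar>\<^sup>2 \<le> det A * det B\<close> (\<open>det_block12_le\<close>), which comes from the Schur
    complement of \<open>A\<close>.  Since \<open>det G = sqrt (det A * det B)\<close>, it says
    \<open>s\<^sub>1 s\<^sub>2 \<le> \<lambda>\<^sub>1(G) \<lambda>\<^sub>2(G)\<close>, which is the top instance of the lg-property and holds for every
    positive semidefinite \<open>M\<close>.
  \<^item> The matrix AM-GM inequality \<open>2 G \<le> A + B\<close> in the Loewner order, which gives
    \<open>2 \<lambda>\<^sub>2(G) \<le> \<lambda>\<^sub>2(A + B)\<close>.

  The first instance of the la-property is the first instance of the a-property.  So if the
  a-property fails, it fails at the second index: \<open>\<lambda>\<^sub>2(A + B) < 2 s\<^sub>2\<close>, and AM-GM yields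
  \<open>\<lambda>\<^sub>2(G) < s\<^sub>2\<close>.  Then \<open>s\<^sub>1 s\<^sub>2 \<le> \<lambda>\<^sub>1(G) \<lambda>\<^sub>2(G) \<le> \<lambda>\<^sub>1(G) s\<^sub>2\<close>, and cancelling \<open>s\<^sub>2 > 0\<close> gives
  \<open>s\<^sub>1 \<le> \<lambda>\<^sub>1(G)\<close>, the remaining instance of the lg-property.

  Most of the work lies in reaching the definitions.  Eigenvalues enter through trace and
  determinant (\<open>eigval_2_facts\<close>).  Square roots and geometric means of positive definite
  \<open>2 \<times> 2\<close> matrices are computed in closed form by the Cayley-Hamilton theorem (\<open>mat_sqrt_2\<close>,
  \<open>geom_mean_pd_2\<close>).  The closed form serves to show that the limit defining the geometric mean
  exists for positive semidefinite arguments (\<open>geom_mean_formula_converges\<close>); afterwards the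
  determinant formula and AM-GM pass to the limit (\<open>geom_mean_2\<close>).
\<close>

(* The symbol $ denotes vector components throughout, not coefficients of power series. *)
no_notation fps_nth (infixl "$" 75)

section \<open>Adjoints, the Hermitian form and positive semidefinite matrices\<close>

lemma adj_adj [simp]: "adj (adj A) = A"
  by (simp add: adj_def vec_eq_iff)

lemma adj_matrix_mult: "adj (A ** B) = adj B ** adj A"
  by (simp add: adj_def vec_eq_iff matrix_matrix_mult_def mult.commute)

lemma adj_add: "adj (A + B) = adj A + adj B"
  by (simp add: adj_def vec_eq_iff)

lemma adj_diff: "adj (A - B) = adj A - adj B"
  by (simp add: adj_def vec_eq_iff)

lemma adj_scaleR: "adj (c *\<^sub>R A) = c *\<^sub>R adj A"
  by (simp add: adj_def vec_eq_iff)

lemma adj_mat_1 [simp]: "adj (mat 1) = mat 1"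
  by (simp add: adj_def vec_eq_iff mat_def)

lemma cinner_0 [simp]: "cinner 0 x = 0" "cinner x 0 = 0"
  by (simp_all add: cinner_def)

lemma cinner_add_right: "cinner x (y + z) = cinner x y + cinner x z"
  by (simp add: cinner_def algebra_simps sum.distrib)

lemma cinner_scaleR_right: "cinner x (c *\<^sub>R y) = c *\<^sub>R cinner x y"
  by (simp add: cinner_def scaleR_sum_right)

lemma cinner_minus_left: "cinner (- x) y = - cinner x y"
  by (simp add: cinner_def sum_negf)

lemma cinner_minus_right: "cinner x (- y) = - cinner x y"
  by (simp add: cinner_def sum_negf)

lemma cinner_commute: "cinner y x = cnj (cinner x y)"
  by (simp add: cinner_def mult.commute)

lemma cinner_self: "cinner x x = of_real (\<Sum>i\<in>UNIV. (cmod (x$i))\<^sup>2)"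
  by (simp add: cinner_def complex_norm_square mult.commute flip: of_real_power)

lemma cinner_adj: "cinner x (A *v y) = cinner (adj A *v x) y"
proof -
  have "cinner x (A *v y) = (\<Sum>i\<in>UNIV. \<Sum>j\<in>UNIV. cnj (x$i) * (A$i$j * y$j))"
    by (simp add: cinner_def matrix_vector_mult_def sum_distrib_left)
  also have "\<dots> = (\<Sum>j\<in>UNIV. \<Sum>i\<in>UNIV. cnj (x$i) * (A$i$j * y$j))"
    by (rule sum.swap)
  also have "\<dots> = cinner (adj A *v x) y"
    by (simp add: cinner_def matrix_vector_mult_def adj_def sum_distrib_right mult.assoc mult.left_commute)
  finally show ?thesis .
qed

lemma matrix_vector_mult_scaleR_left: "(c *\<^sub>R A) *v x = c *\<^sub>R (A *v (x :: complex^'n))"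
  by (simp add: vec_eq_iff matrix_vector_mult_def scaleR_sum_right)

lemma matrix_mult_scaleR_left: "(c *\<^sub>R A) ** B = c *\<^sub>R (A ** (B :: complex^'n^'m))"
  by (simp add: vec_eq_iff matrix_matrix_mult_def scaleR_sum_right)

lemma matrix_mult_scaleR_right: "A ** (c *\<^sub>R B) = c *\<^sub>R (A ** (B :: complex^'n^'m))"
  by (simp add: vec_eq_iff matrix_matrix_mult_def scaleR_sum_right)

lemma matrix_mult_distrib:
  fixes A B C :: "complex^'n^'n"
  shows "A ** (B - C) = A ** B - A ** C" "(B - C) ** A = B ** A - C ** A"
    and "A ** (B + C) = A ** B + A ** C" "(B + C) ** A = B ** A + C ** A"
  by (simp_all add: vec_eq_iff matrix_matrix_mult_def algebra_simps sum_subtractf sum.distrib)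

lemma matrix_inv_mult:
  assumes "invertible (A :: complex^'n^'n)"
  shows "matrix_inv A ** A = mat 1" "A ** matrix_inv A = mat 1"
  using someI_ex[OF assms[unfolded invertible_def]] by (simp_all add: matrix_inv_def)

lemma hermitian_scaleR: "hermitian A \<Longrightarrow> hermitian (c *\<^sub>R A)"
  by (simp add: hermitian_def adj_scaleR)

lemma hermitian_add: "hermitian A \<Longrightarrow> hermitian B \<Longrightarrow> hermitian (A + B)"
  by (simp add: hermitian_def adj_add)

lemma hermitian_mat_1: "hermitian (mat 1)"
  by (simp add: hermitian_def)

lemma pos_semidef_hermitian: "pos_semidef A \<Longrightarrow> hermitian A"
  by (simp add: pos_semidef_def)

lemma pos_semidef_add: "pos_semidef A \<Longrightarrow> pos_semidef B \<Longrightarrow> pos_semidef (A + B)"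
  by (simp add: pos_semidef_def hermitian_def adj_add matrix_vector_mult_add_rdistrib cinner_add_right)

lemma pos_semidef_scaleR: "pos_semidef A \<Longrightarrow> 0 \<le> c \<Longrightarrow> pos_semidef (c *\<^sub>R A)"
  by (simp add: pos_semidef_def hermitian_def adj_scaleR matrix_vector_mult_scaleR_left cinner_scaleR_right)

lemma pos_semidef_mat_1: "pos_semidef (mat 1)"
  by (simp add: pos_semidef_def hermitian_def cinner_self sum_nonneg)

lemma pos_semidef_shift:
  "pos_semidef A \<Longrightarrow> 0 \<le> \<mu> \<Longrightarrow> pos_semidef (A + \<mu> *\<^sub>R mat 1)"
  by (simp add: pos_semidef_add pos_semidef_mat_1 pos_semidef_scaleR)

lemma pos_semidef_congruence:
  assumes "pos_semidef A"
  shows "pos_semidef (adj W ** A ** W)"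
proof -
  have "cinner x ((adj W ** A ** W) *v x) = cinner (W *v x) (A *v (W *v x))" for x
    by (metis cinner_adj adj_adj matrix_vector_mul_assoc)
  with assms show ?thesis
    by (simp add: pos_semidef_def hermitian_def adj_matrix_mult matrix_mul_assoc)
qed

lemma pos_semidef_adj_mult: "pos_semidef (adj X ** X)"
  using pos_semidef_congruence[OF pos_semidef_mat_1, of X] by simp

text \<open>
  Both defining conditions are closed: an equation between entries, and a weak inequality for each
  vector.  This carries positivity over to the limit in the definition of the geometric mean.
\<close>

lemma pos_semidef_limit:
  fixes F :: "'a \<Rightarrow> complex^'n^'n"
  assumes "(F \<longlongrightarrow> L) net" "\<forall>\<^sub>F x in net. pos_semidef (F x)" "net \<noteq> bot"
  shows "pos_semidef L"
proof -
  have "L $ j $ i = cnj (L $ i $ j)" for i j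
  proof (rule tendsto_unique[OF assms(3)])
    show "((\<lambda>x. F x $ j $ i) \<longlongrightarrow> L $ j $ i) net"
      by (intro tendsto_intros assms)
    have "\<forall>\<^sub>F x in net. cnj (F x $ i $ j) = F x $ j $ i"
      using assms(2) by eventually_elim
        (auto simp: pos_semidef_def hermitian_def adj_def vec_eq_iff)
    moreover have "((\<lambda>x. cnj (F x $ i $ j)) \<longlongrightarrow> cnj (L $ i $ j)) net"
      by (intro tendsto_intros assms)
    ultimately show "((\<lambda>x. F x $ j $ i) \<longlongrightarrow> cnj (L $ i $ j)) net"
      by (rule Lim_transform_eventually[rotated])
  qed
  then have "hermitian L" unfolding hermitian_def adj_def vec_eq_iff by (metis vec_lambda_beta)
  moreover have "0 \<le> Re (cinner v (L *v v))" for v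
  proof (rule tendsto_lowerbound[OF _ _ assms(3)])
    show "((\<lambda>x. Re (cinner v (F x *v v))) \<longlongrightarrow> Re (cinner v (L *v v))) net"
      unfolding cinner_def matrix_vector_mult_def vec_lambda_beta by (intro tendsto_intros assms)
    show "\<forall>\<^sub>F x in net. 0 \<le> Re (cinner v (F x *v v))"
      using assms(2) by eventually_elim (simp add: pos_semidef_def)
  qed
  ultimately show ?thesis by (simp add: pos_semidef_def)
qed

section \<open>Hermitian matrices of size two\<close>

lemma trace_2: "trace (A :: complex^2^2) = A$1$1 + A$2$2"
  by (simp add: trace_def sum_2)

lemma hermitian_2_iff:
  "hermitian (H :: complex^2^2) \<longleftrightarrow> Im (H$1$1) = 0 \<and> Im (H$2$2) = 0 \<and> H$2$1 = cnj (H$1$2)"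
  by (auto simp: hermitian_def adj_def vec_eq_iff forall_2 complex_eq_iff)

lemma hermitian_2_obtain:
  fixes H :: "complex^2^2"
  assumes "hermitian H"
  obtains a d b where "H$1$1 = of_real a" "H$2$2 = of_real d" "H$1$2 = b" "H$2$1 = cnj b"
  using assms by (metis hermitian_2_iff complex_surj complex_of_real_def)

lemma Re_det_2:
  assumes "hermitian (H :: complex^2^2)"
  shows "Re (det H) = Re (H$1$1) * Re (H$2$2) - (cmod (H$1$2))\<^sup>2" "Im (det H) = 0"
  using assms by (simp_all add: hermitian_2_iff det_2 cmod_def power2_eq_square)

lemma Re_det_mult_2:
  fixes A B :: "complex^2^2"
  assumes "hermitian A" "hermitian B"
  shows "Re (det (A ** B)) = Re (det A) * Re (det B)"
  using Re_det_2(2)[OF assms(1)] by (simp add: det_mul)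

lemma det_scaleR_2: "det (c *\<^sub>R (A :: complex^2^2)) = c\<^sup>2 *\<^sub>R det A"
  by (simp add: det_2 power2_eq_square scaleR_right_diff_distrib)

lemma det_adj_2: "det (adj (X :: complex^2^2)) = cnj (det X)"
  by (simp add: det_2 adj_def mult.commute)

lemma Re_det_adj_mult_2: "Re (det (adj X ** (X :: complex^2^2))) = (cmod (det X))\<^sup>2"
  by (simp add: det_mul det_adj_2 cmod_power2 flip: power2_eq_square)

text \<open>
  With diagonal \<open>a\<close>, \<open>d\<close> and off-diagonal entry \<open>\<beta>\<close>, completing the square gives
  \<open>a * q(x) = \<bar>a x\<^sub>1 + \<beta> x\<^sub>2\<bar>\<^sup>2 + det H * \<bar>x\<^sub>2\<bar>\<^sup>2\<close> for the quadratic form \<open>q\<close> of \<open>H\<close>.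
\<close>

lemma pos_semidef_2_iff:
  fixes H :: "complex^2^2"
  shows "pos_semidef H \<longleftrightarrow> hermitian H \<and> 0 \<le> Re (trace H) \<and> 0 \<le> Re (det H)"
proof (cases "hermitian H")
  case True
  obtain a d b c where H: "H$1$1 = of_real a" "H$2$2 = of_real d" "H$1$2 = Complex b c" 
     "H$2$1 = Complex b (- c)"
    using True by (metis hermitian_2_iff complex_surj complex_cnj complex_of_real_def)
  have q: "Re (cinner x (H *v x)) = a * (cmod (x$1))\<^sup>2 + d * (cmod (x$2))\<^sup>2
      + 2 * Re (cnj (x$1) * Complex b c * x$2)" for x
    by (simp add: cinner_def matrix_vector_mult_def sum_2 H cmod_def power2_eq_square algebra_simps)
  have td: "Re (trace H) = a + d" "Re (det H) = a * d - (b\<^sup>2 + c\<^sup>2)"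
    by (simp_all add: trace_2 det_2 H power2_eq_square)
  show ?thesis
  proof
    assume "pos_semidef H"
    then have *: "0 \<le> Re (cinner x (H *v x))" for x by (simp add: pos_semidef_def)
    have a: "0 \<le> a" using *[of "vector [1, 0]"] by (simp add: q)
    have d: "0 \<le> d" using *[of "vector [0, 1]"] by (simp add: q)
    \<comment> \<open>These vectors extract the determinant, up to a nonnegative factor; the third one settles
      \<open>a = d = 0\<close>.\<close>
    have 1: "0 \<le> a * (a * d - (b\<^sup>2 + c\<^sup>2))"
      using *[of "vector [Complex (-b) (-c), of_real a]"]
      by (simp add: q cmod_def power2_eq_square algebra_simps)
    have 2: "0 \<le> d * (a * d - (b\<^sup>2 + c\<^sup>2))"
      using *[of "vector [of_real d, Complex (-b) c]"]
      by (simp add: q cmod_def power2_eq_square algebra_simps)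
    have 3: "0 \<le> a * (b\<^sup>2 + c\<^sup>2) + d - 2 * (b\<^sup>2 + c\<^sup>2)"
      using *[of "vector [Complex (-b) (-c), 1]"]
      by (simp add: q cmod_def power2_eq_square algebra_simps)
    have "0 \<le> a * d - (b\<^sup>2 + c\<^sup>2)"
    proof (cases "a = 0 \<and> d = 0")
      case True
      with 3 show ?thesis by simp
    next
      case False
      with a d 1 2 show ?thesis by (smt (verit) mult_pos_neg)
    qed
    with a d True show "hermitian H \<and> 0 \<le> Re (trace H) \<and> 0 \<le> Re (det H)"
      by (simp add: td)
  next
    assume "hermitian H \<and> 0 \<le> Re (trace H) \<and> 0 \<le> Re (det H)"
    then have ad: "0 \<le> a + d" "b\<^sup>2 + c\<^sup>2 \<le> a * d" by (auto simp: td)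
    have "0 \<le> a * d" using ad(2) by (smt (verit) zero_le_power2)
    with ad(1) have a: "0 \<le> a" and d: "0 \<le> d"
      by (smt (verit) mult_pos_neg mult_neg_pos zero_le_mult_iff)+
    have "0 \<le> Re (cinner x (H *v x))" for x
    proof (cases "a = 0")
      case True
      with ad(2) have "b = 0" "c = 0" by (simp_all add: sum_power2_le_zero_iff)
      with True d show ?thesis by (simp add: q zero_complex.code[symmetric])
    next
      case False
      have "a * Re (cinner x (H *v x)) = (cmod (of_real a * x$1 + Complex b c * x$2))\<^sup>2
          + (a * d - (b\<^sup>2 + c\<^sup>2)) * (cmod (x$2))\<^sup>2"
        unfolding q cmod_power2 by (simp add: power2_eq_square algebra_simps)
      also have "0 \<le> \<dots>" using ad by simp
      finally show ?thesis using False a by (simp add: zero_le_mult_iff)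
    qed
    with True show "pos_semidef H" by (simp add: pos_semidef_def)
  qed
qed (simp add: pos_semidef_def)

lemma pos_semidef_2_entries:
  fixes A :: "complex^2^2"
  assumes "pos_semidef A"
  shows "0 \<le> Re (A$1$1)" "0 \<le> Re (A$2$2)" "(cmod (A$1$2))\<^sup>2 \<le> Re (A$1$1) * Re (A$2$2)"
proof -
  have h: "hermitian A" and "0 \<le> Re (trace A)" "0 \<le> Re (det A)"
    using assms by (simp_all add: pos_semidef_2_iff)
  then have 1: "0 \<le> Re (A$1$1) + Re (A$2$2)" and 2: "(cmod (A$1$2))\<^sup>2 \<le> Re (A$1$1) * Re (A$2$2)"
    by (simp_all add: trace_2 Re_det_2)
  have "0 \<le> Re (A$1$1) * Re (A$2$2)" using 2 by (smt (verit) zero_le_power2)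
  with 1 2 show "0 \<le> Re (A$1$1)" "0 \<le> Re (A$2$2)" "(cmod (A$1$2))\<^sup>2 \<le> Re (A$1$1) * Re (A$2$2)"
    by (smt (verit) zero_le_mult_iff)+
qed

lemma cayley_hamilton_hermitian_2:
  fixes A :: "complex^2^2"
  assumes "hermitian A"
  shows "A ** A = Re (trace A) *\<^sub>R A - Re (det A) *\<^sub>R mat 1"
proof -
  obtain a d b where A: "A$1$1 = of_real a" "A$2$2 = of_real d" "A$1$2 = b" "A$2$1 = cnj b"
    using hermitian_2_obtain[OF assms] by metis
  have "b * cnj b = of_real (Re (b * cnj b))" by (simp add: complex_eq_iff)
  then show ?thesis
    by (simp add: vec_eq_iff forall_2 matrix_matrix_mult_def sum_2 mat_def A trace_2 det_2
        algebra_simps complex_eq_iff)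
qed

text \<open>
  The polarization of the determinant, a quadratic form on \<open>2 \<times> 2\<close> matrices: the coefficient
  of \<open>r\<close> in \<open>det (A + r B)\<close>.
\<close>

definition mixed_det :: "complex^2^2 \<Rightarrow> complex^2^2 \<Rightarrow> real" where
  "mixed_det A B = Re (det (A + B)) - Re (det A) - Re (det B)"

lemma mixed_det_commute: "mixed_det A B = mixed_det B A"
  by (simp add: mixed_det_def add.commute)

lemma mixed_det_hermitian:
  assumes "hermitian A" "hermitian B"
  shows "mixed_det A B = Re (A$1$1) * Re (B$2$2) + Re (A$2$2) * Re (B$1$1) - 2 * Re (A$1$2 * cnj (B$1$2))"
  using assms by (simp add: mixed_det_def det_2 hermitian_2_iff algebra_simps)

lemma Re_det_add_scaleR:
  "Re (det (A + r *\<^sub>R B)) = Re (det A) + r * mixed_det A B + r\<^sup>2 * Re (det B)"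
  by (simp add: mixed_det_def det_2 algebra_simps power2_eq_square)

lemma mixed_det_mat_1: "mixed_det A (mat 1) = Re (trace A)"
  by (simp add: mixed_det_def det_2 trace_2 mat_def algebra_simps)

lemma Re_det_shift:
  "Re (det (A + \<mu> *\<^sub>R mat 1 :: complex^2^2)) = Re (det A) + \<mu> * Re (trace A) + \<mu>\<^sup>2"
  by (simp add: Re_det_add_scaleR mixed_det_mat_1)

lemma Re_det_shift_pos:
  assumes "pos_semidef (A :: complex^2^2)" "0 < \<mu>"
  shows "0 < Re (det (A + \<mu> *\<^sub>R mat 1))"
  using assms by (simp add: Re_det_shift pos_semidef_2_iff add_nonneg_pos)

lemma mixed_det_shift:
  "mixed_det (A + \<mu> *\<^sub>R mat 1) (B + \<mu> *\<^sub>R mat 1)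
     = mixed_det A B + \<mu> * (Re (trace A) + Re (trace B)) + 2 * \<mu>\<^sup>2"
  by (simp add: mixed_det_def det_2 trace_2 mat_def algebra_simps power2_eq_square)

text \<open>
  The two diagonal products in the mixed determinant have the geometric mean
  \<open>sqrt (a\<^sub>1 a\<^sub>2 b\<^sub>1 b\<^sub>2)\<close>, which bounds the product of the off-diagonal moduli; so AM-GM for real
  numbers suffices.
\<close>

lemma mixed_det_nonneg:
  assumes "pos_semidef A" "pos_semidef B"
  shows "0 \<le> mixed_det A B"
proof -
  note a = pos_semidef_2_entries[OF assms(1)] and b = pos_semidef_2_entries[OF assms(2)]
  let ?x = "Re (A$1$1) * Re (B$2$2)" and ?y = "Re (A$2$2) * Re (B$1$1)"
  have "(cmod (A$1$2) * cmod (B$1$2))\<^sup>2 \<le> (Re (A$1$1) * Re (A$2$2)) * (Re (B$1$1) * Re (B$2$2))"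
    using a b by (simp add: power_mult_distrib mult_mono)
  also have "\<dots> = ?x * ?y" by simp
  also have "\<dots> \<le> ((?x + ?y) / 2)\<^sup>2"
    using zero_le_power2[of "?x - ?y"] by (simp add: power2_eq_square field_simps)
  finally have "cmod (A$1$2) * cmod (B$1$2) \<le> (?x + ?y) / 2"
    by (rule power2_le_imp_le) (use a b in simp)
  moreover have "Re (A$1$2 * cnj (B$1$2)) \<le> cmod (A$1$2) * cmod (B$1$2)"
    by (metis complex_Re_le_cmod norm_mult complex_mod_cnj)
  moreover have "mixed_det A B = ?x + ?y - 2 * Re (A$1$2 * cnj (B$1$2))"
    using assms by (simp add: mixed_det_hermitian pos_semidef_def)
  moreover have "0 \<le> m" if "p \<le> s / 2" "q \<le> p" "m = s - 2 * q" for m p q s :: real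
    using that by simp
  ultimately show ?thesis by blast
qed

text \<open>
  The equality case of the preceding estimate: a definite \<open>B\<close> makes the bound strict as soon as
  \<open>A\<close> has a nonzero off-diagonal entry.
\<close>

lemma mixed_det_eq_0_imp_eq_0:
  assumes A: "pos_semidef A" and B: "pos_semidef B"
    and "Re (det A) = 0" "0 < Re (det B)" "mixed_det A B = 0"
  shows "A = 0"
proof -
  note a = pos_semidef_2_entries[OF A] and b = pos_semidef_2_entries[OF B]
  have hA: "hermitian A" and hB: "hermitian B" using A B by (simp_all add: pos_semidef_def)
  let ?x = "Re (A$1$1) * Re (B$2$2)" and ?y = "Re (A$2$2) * Re (B$1$1)"
  have detA: "(cmod (A$1$2))\<^sup>2 = Re (A$1$1) * Re (A$2$2)" 
    and detB: "(cmod (B$1$2))\<^sup>2 < Re (B$1$1) * Re (B$2$2)"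
    using assms by (simp_all add: Re_det_2 hA hB)
  have "Re (A$1$2 * cnj (B$1$2)) \<le> cmod (A$1$2) * cmod (B$1$2)"
    by (metis complex_Re_le_cmod norm_mult complex_mod_cnj)
  then have le: "?x + ?y \<le> 2 * (cmod (A$1$2) * cmod (B$1$2))"
    using assms(5) by (simp add: mixed_det_hermitian hA hB)
  have xy: "0 \<le> ?x" "0 \<le> ?y" using a b by simp_all
  have 12: "A$1$2 = 0"
  proof (rule ccontr)
    assume "A$1$2 \<noteq> 0"
    then have "(cmod (A$1$2))\<^sup>2 * (cmod (B$1$2))\<^sup>2 < (cmod (A$1$2))\<^sup>2 * (Re (B$1$1) * Re (B$2$2))"
      using detB by simp
    also have "\<dots> = ?x * ?y" unfolding detA by simp
    also have "\<dots> \<le> ((?x + ?y) / 2)\<^sup>2"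
      using zero_le_power2[of "?x - ?y"] by (simp add: power2_eq_square field_simps)
    also have "\<dots> \<le> (cmod (A$1$2) * cmod (B$1$2))\<^sup>2"
      using le xy by (intro power_mono) auto
    finally show False by (simp add: power_mult_distrib)
  qed
  with le have "?x + ?y \<le> 0" by simp
  with xy have "?x = 0" "?y = 0" by (smt (verit))+
  moreover have "0 < Re (B$1$1) * Re (B$2$2)" using detB by (smt (verit) zero_le_power2)
  ultimately have "Re (A$1$1) = 0" "Re (A$2$2) = 0" by auto
  with 12 hA show ?thesis
    by (simp add: vec_eq_iff forall_2 hermitian_2_iff complex_eq_iff)
qed

lemma Re_det_mono:
  assumes "pos_semidef C" "pos_semidef (B - C)"
  shows "Re (det (C :: complex^2^2)) \<le> Re (det B)"
  using mixed_det_nonneg[OF assms] assms(2) by (simp add: mixed_det_def pos_semidef_2_iff)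

section \<open>Eigenvalues and singular values\<close>

text \<open>
  The characteristic polynomial \<open>x\<^sup>2 - tr H x + det H\<close> has the discriminant
  \<open>(a - d)\<^sup>2 + 4 \<bar>\<beta>\<bar>\<^sup>2 \<ge> 0\<close>, where \<open>a\<close>, \<open>d\<close> are the diagonal entries of \<open>H\<close> and \<open>\<beta>\<close> is the
  off-diagonal one; so it splits over the reals.
\<close>

lemma eigval_2_facts:
  fixes H :: "complex^2^2"
  assumes "hermitian H"
  shows eigval_2_antimono: "eigval H 2 \<le> eigval H 1"
    and eigval_2_sum: "eigval H 1 + eigval H 2 = Re (trace H)"
    and eigval_2_prod: "eigval H 1 * eigval H 2 = Re (det H)"
proof -
  define t where "t = Re (trace H)"
  define d where "d = Re (det H)"
  define r where "r = sqrt (t\<^sup>2 - 4 * d)"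
  have "t\<^sup>2 - 4 * d = (Re (H$1$1) - Re (H$2$2))\<^sup>2 + 4 * (cmod (H$1$2))\<^sup>2"
    by (simp add: t_def d_def Re_det_2[OF assms] trace_2 power2_eq_square algebra_simps)
  then have r: "0 \<le> r" "r\<^sup>2 = t\<^sup>2 - 4 * d" by (simp_all add: r_def)
  define l1 l2 where "l1 = (t + r) / 2" and "l2 = (t - r) / 2"
  have l: "l1 + l2 = t" "l1 * l2 = d" "l2 \<le> l1"
    using r by (simp_all add: l1_def l2_def power2_eq_square field_simps)
  have T: "complex_of_real t = trace H" "complex_of_real d = det H"
    using assms Re_det_2[OF assms] by (simp_all add: t_def d_def complex_eq_iff hermitian_2_iff trace_2)
  have "charpoly H = [:det H, - trace H, 1:]"
    by (simp add: charpoly_def det_2 trace_2)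
  also have "\<dots> = [:- of_real l1, 1:] * [:- of_real l2, 1:]"
    by (simp add: T[symmetric] l(1)[symmetric] l(2)[symmetric])
  finally have "proots (charpoly H) = {#of_real l1, of_real l2#}"
    by (simp add: proots_mult del: mult_pCons_left mult_pCons_right)
  then have "eigval H j = rev [l2, l1] ! (j - 1)" for j
    using l(3) by (simp add: eigval_def)
  then show "eigval H 2 \<le> eigval H 1" "eigval H 1 + eigval H 2 = Re (trace H)"
    "eigval H 1 * eigval H 2 = Re (det H)"
    using l by (simp_all add: t_def d_def)
qed

text \<open>
  Together with the next lemma this characterizes the smaller eigenvalue as the largest \<open>\<mu>\<close> with
  \<open>\<mu> I \<le> H\<close>, which makes it monotone in the Loewner order.
\<close>

lemma pos_semidef_minus_eigval_2:
  assumes H: "hermitian (H :: complex^2^2)"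
  shows "pos_semidef (H - eigval H 2 *\<^sub>R mat 1)"
proof -
  define u v where "u = eigval H 1" and "v = eigval H 2"
  note e = eigval_2_facts[OF H, folded u_def v_def]
  have "hermitian (H + (- v) *\<^sub>R mat 1)"
    by (intro hermitian_add hermitian_scaleR H hermitian_mat_1)
  moreover have "Re (trace (H + (- v) *\<^sub>R mat 1)) = Re (trace H) - 2 * v"
    by (simp add: trace_2 mat_def)
  moreover have "Re (det (H + (- v) *\<^sub>R mat 1)) = 0"
    unfolding Re_det_shift e(2)[symmetric] e(3)[symmetric]
    by (simp add: algebra_simps power2_eq_square)
  ultimately have "pos_semidef (H + (- v) *\<^sub>R mat 1)"
    using e(1,2) by (simp add: pos_semidef_2_iff)
  then show ?thesis by (simp add: v_def)
qed

lemma le_eigval_2: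
  assumes H: "hermitian (H :: complex^2^2)" and psd: "pos_semidef (H - \<mu> *\<^sub>R mat 1)"
  shows "\<mu> \<le> eigval H 2"
proof (rule ccontr)
  define u v where "u = eigval H 1" and "v = eigval H 2"
  note e = eigval_2_facts[OF H, folded u_def v_def]
  assume "\<not> \<mu> \<le> eigval H 2"
  then have v: "v < \<mu>" by (simp add: v_def)
  have "Re (trace (H - \<mu> *\<^sub>R mat 1)) = Re (trace H) - 2 * \<mu>"
    by (simp add: trace_2 mat_def)
  then have t: "0 \<le> u + v - 2 * \<mu>" using psd e(2) by (simp add: pos_semidef_2_iff)
  have "Re (det (H - \<mu> *\<^sub>R mat 1)) = (u - \<mu>) * (v - \<mu>)"
    using Re_det_shift[of H "- \<mu>"] unfolding e(2)[symmetric] e(3)[symmetric]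
    by (simp add: algebra_simps power2_eq_square)
  then have "0 \<le> (u - \<mu>) * (v - \<mu>)" using psd by (simp add: pos_semidef_2_iff)
  with v t show False by (simp add: zero_le_mult_iff)
qed

lemma singval_2:
  fixes X :: "complex^2^2"
  shows "0 \<le> singval X 2" "singval X 2 \<le> singval X 1" "singval X 1 * singval X 2 = cmod (det X)"
proof -
  have h: "hermitian (adj X ** X)" by (simp add: pos_semidef_adj_mult pos_semidef_hermitian)
  have "0 \<le> eigval (adj X ** X) 2"
    by (rule le_eigval_2[OF h]) (simp add: pos_semidef_adj_mult)
  then show "0 \<le> singval X 2" "singval X 2 \<le> singval X 1"
    using eigval_2_antimono[OF h] by (simp_all add: singval_def)
  show "singval X 1 * singval X 2 = cmod (det X)"
    unfolding singval_def real_sqrt_mult[symmetric] eigval_2_prod[OF h] Re_det_adj_mult_2 by simp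
qed

section \<open>Square roots and geometric means of positive definite matrices\<close>

text \<open>
  A positive semidefinite root \<open>S\<close> of \<open>A\<close> satisfies \<open>A = tr S * S - det S * I\<close> by
  Cayley-Hamilton.  Here \<open>det S = sqrt (det A)\<close>, and taking traces determines \<open>tr S\<close>; hence \<open>S\<close> is
  the matrix displayed below.
\<close>

lemma mat_sqrt_2:
  fixes A :: "complex^2^2"
  assumes A: "pos_semidef A" and pos: "0 < Re (det A)"
  defines "r \<equiv> sqrt (Re (det A))"
  defines "t \<equiv> sqrt (Re (trace A) + 2 * r)"
  shows "mat_sqrt A = (1 / t) *\<^sub>R (A + r *\<^sub>R mat 1)"
    and "pos_semidef (mat_sqrt A)"
    and "mat_sqrt A ** mat_sqrt A = A"
    and "0 < t"
proof -
  have h: "hermitian A" and trA: "0 \<le> Re (trace A)"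
    using A by (simp_all add: pos_semidef_2_iff)
  have r: "0 < r" "r\<^sup>2 = Re (det A)" using pos by (simp_all add: r_def)
  with trA have t: "0 < t" "t\<^sup>2 = Re (trace A) + 2 * r" by (simp_all add: t_def)
  define S where "S = (1 / t) *\<^sub>R (A + r *\<^sub>R mat 1)"
  have S: "pos_semidef S"
    unfolding S_def using A r t by (intro pos_semidef_scaleR pos_semidef_add pos_semidef_mat_1) auto
  have "(A + r *\<^sub>R mat 1) ** (A + r *\<^sub>R mat 1) = A ** A + (2 * r) *\<^sub>R A + r\<^sup>2 *\<^sub>R mat 1"
    by (simp add: vec_eq_iff forall_2 matrix_matrix_mult_def sum_2 mat_def
        algebra_simps power2_eq_square complex_eq_iff)
  also have "\<dots> = t\<^sup>2 *\<^sub>R A"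
    by (simp add: cayley_hamilton_hermitian_2[OF h] r t algebra_simps)
  finally have "(A + r *\<^sub>R mat 1) ** (A + r *\<^sub>R mat 1) = t\<^sup>2 *\<^sub>R A" .
  moreover have "S ** S = (1 / t\<^sup>2) *\<^sub>R ((A + r *\<^sub>R mat 1) ** (A + r *\<^sub>R mat 1))"
    unfolding S_def
    by (simp add: matrix_mult_scaleR_left matrix_mult_scaleR_right power2_eq_square)
  ultimately have SS: "S ** S = A" using t(1) by simp
  have uniq: "S' = S" if S': "pos_semidef S' \<and> S' ** S' = A" for S'
  proof -
    have h': "hermitian S'" and nn: "0 \<le> Re (det S')" "0 \<le> Re (trace S')"
      using S' by (simp_all add: pos_semidef_2_iff)
    have "Re (det A) = (Re (det S'))\<^sup>2"
      using Re_det_mult_2[OF h' h'] S' by (simp add: power2_eq_square)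
    then have det: "Re (det S') = r" using nn by (simp add: r_def)
    have ch: "A = Re (trace S') *\<^sub>R S' - r *\<^sub>R mat 1"
      using cayley_hamilton_hermitian_2[OF h'] S' det by simp
    have "Re (trace A) = Re (trace (Re (trace S') *\<^sub>R S' - r *\<^sub>R mat 1))"
      using ch by (rule arg_cong)
    also have "\<dots> = Re (trace S') * Re (trace S') - 2 * r"
      by (simp add: trace_2 mat_def algebra_simps)
    finally have "Re (trace A) = Re (trace S') * Re (trace S') - 2 * r" .
    then have tr: "Re (trace S') = t" using nn by (simp add: t_def)
    have "A + r *\<^sub>R mat 1 = t *\<^sub>R S'" using ch unfolding tr by (metis diff_add_cancel)
    then have "S = (1 / t) *\<^sub>R (t *\<^sub>R S')" by (simp only: S_def)
    then show "S' = S" using t(1) by simp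
  qed
  have sqrt_A: "mat_sqrt A = S"
    unfolding mat_sqrt_def
  proof (rule the_equality)
    show "pos_semidef S \<and> S ** S = A" using S SS by (rule conjI)
  qed (rule uniq)
  then show "mat_sqrt A = (1 / t) *\<^sub>R (A + r *\<^sub>R mat 1)"
    unfolding S_def .
  show "pos_semidef (mat_sqrt A)"
    unfolding sqrt_A by (rule S)
  show "mat_sqrt A ** mat_sqrt A = A"
    unfolding sqrt_A by (rule SS)
  show "0 < t"
    by (rule t(1))
qed

text \<open>
  The geometric mean in terms of determinants alone.  It is symmetric in \<open>A\<close> and \<open>B\<close> and
  contains no matrix inverse, so that its behaviour near singular arguments can be read off.
\<close>

definition geom_mean_formula :: "complex^2^2 \<Rightarrow> complex^2^2 \<Rightarrow> complex^2^2" where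
  "geom_mean_formula A B =
     (let \<alpha> = sqrt (Re (det A)); \<beta> = sqrt (Re (det B)); s = sqrt (mixed_det A B + 2 * (\<alpha> * \<beta>))
      in (\<beta> / s) *\<^sub>R A + (\<alpha> / s) *\<^sub>R B)"

lemma geom_mean_formula_commute: "geom_mean_formula A B = geom_mean_formula B A"
  by (simp add: geom_mean_formula_def Let_def mixed_det_commute[of A B] mult.commute add.commute)

text \<open>
  Let \<open>R = B\<^sup>1\<^sup>/\<^sup>2\<close> and \<open>C = R\<^sup>-\<^sup>1 A R\<^sup>-\<^sup>1\<close>.  The root \<open>S\<close> of \<open>C\<close> is a combination of \<open>C\<close> and \<open>I\<close>, so
  \<open>G = R S R\<close> is a combination \<open>c (A + r B)\<close> of \<open>A = R C R\<close> and \<open>B = R R\<close>; the factor \<open>c\<close> follows by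
  comparing determinants.  AM-GM is the identity \<open>A + B - 2 G = R (S - I)\<^sup>2 R\<close>.
\<close>

lemma geom_mean_pd_2:
  fixes A B :: "complex^2^2"
  assumes A: "pos_semidef A" and B: "pos_semidef B"
    and dA: "0 < Re (det A)" and dB: "0 < Re (det B)"
  defines "\<alpha> \<equiv> sqrt (Re (det A))" and "\<beta> \<equiv> sqrt (Re (det B))"
  shows "geom_mean_pd A B = geom_mean_formula A B"
    and "Re (det (geom_mean_pd A B)) = \<alpha> * \<beta>"
    and "pos_semidef (geom_mean_pd A B)"
    and "pos_semidef (A + B - 2 *\<^sub>R geom_mean_pd A B)"
proof -
  define R where "R = mat_sqrt B"
  note R = mat_sqrt_2(2,3)[OF B dB, folded R_def]
  have hR: "adj R = R" using R by (simp add: pos_semidef_def hermitian_def)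
  have ab: "0 < \<alpha>" "0 < \<beta>" "\<alpha>\<^sup>2 = Re (det A)" "\<beta>\<^sup>2 = Re (det B)"
    using dA dB by (simp_all add: \<alpha>_def \<beta>_def)
  have "det R * det R = det B" using R(2) by (metis det_mul)
  with dB have "det R \<noteq> 0" by auto
  then have inv: "invertible R" by (simp add: invertible_det_nz)
  define Q where "Q = matrix_inv R"
  note Q = matrix_inv_mult[OF inv, folded Q_def]
  have "R ** adj Q = mat 1" using Q(1) hR by (metis adj_matrix_mult adj_mat_1)
  then have hQ: "adj Q = Q" using Q(1) by (metis matrix_mul_assoc matrix_mul_lid matrix_mul_rid)
  define C where "C = Q ** A ** Q"
  have C: "pos_semidef C" using pos_semidef_congruence[OF A, of Q] by (simp add: C_def hQ)
  have RCR: "R ** C ** R = A"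
    unfolding C_def using Q by (metis matrix_mul_assoc matrix_mul_lid matrix_mul_rid)
  have det_sandwich: "Re (det (R ** X ** R)) = Re (det X) * Re (det B)" if "hermitian X" for X
  proof -
    have "det (R ** X ** R) = det X * det (R ** R)" by (simp add: det_mul)
    with that B show ?thesis by (simp add: R Re_det_2(2) pos_semidef_hermitian)
  qed
  have dC: "Re (det C) * Re (det B) = Re (det A)"
    using det_sandwich[OF pos_semidef_hermitian[OF C]] RCR by simp
  with dA dB have dC_pos: "0 < Re (det C)" by (metis zero_less_mult_pos2)
  define S where "S = mat_sqrt C"
  note S = mat_sqrt_2[OF C dC_pos, folded S_def]
  define G where "G = R ** S ** R"
  have G: "geom_mean_pd A B = G"
    by (simp add: geom_mean_pd_def Let_def G_def S_def C_def Q_def R_def)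
  have hS: "adj S = S" "hermitian S" using S(2) by (simp_all add: pos_semidef_def hermitian_def)
  define r where "r = sqrt (Re (det C))"
  have "Re (det C) = Re (det A) / Re (det B)" using dC dB by (simp add: field_simps)
  then have r: "r = \<alpha> / \<beta>" by (simp add: r_def \<alpha>_def \<beta>_def real_sqrt_divide)
  have rd: "r\<^sup>2 = Re (det C)" "0 < r" using dC_pos by (simp_all add: r_def)
  define c where "c = 1 / sqrt (Re (trace C) + 2 * r)"
  have c: "0 < c" using S(4) by (simp add: c_def r_def)
  have "G = c *\<^sub>R (R ** C ** R + r *\<^sub>R (R ** R))"
    unfolding G_def S(1) c_def r_def
    by (simp add: matrix_mult_scaleR_left matrix_mult_scaleR_right matrix_mult_distrib)
  then have Gc: "G = c *\<^sub>R (A + r *\<^sub>R B)" by (simp add: RCR R)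
  have "(Re (det S))\<^sup>2 = Re (det C)"
    using Re_det_mult_2[OF hS(2) hS(2)] S(3) by (simp add: power2_eq_square)
  then have "Re (det S) = r" using S(2) by (simp add: r_def pos_semidef_2_iff real_sqrt_unique)
  then have detG: "Re (det G) = \<alpha> * \<beta>"
    using ab by (simp add: G_def det_sandwich hS r power2_eq_square flip: ab(4))
  define m where "m = mixed_det A B"
  have m: "0 \<le> m" using A B by (simp add: m_def mixed_det_nonneg)
  \<comment> \<open>Both sides are \<open>det G\<close>; this determines \<open>c\<close>.\<close>
  have "c\<^sup>2 * (\<alpha>\<^sup>2 + r * m + r\<^sup>2 * \<beta>\<^sup>2) = \<alpha> * \<beta>"
    using detG by (simp add: Gc det_scaleR_2 Re_det_add_scaleR ab m_def)
  then have "(\<alpha> / \<beta>) * (c\<^sup>2 * (m + 2 * (\<alpha> * \<beta>))) = (\<alpha> / \<beta>) * \<beta>\<^sup>2"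
    using ab(1,2) by (simp add: r field_simps power2_eq_square)
  then have "c\<^sup>2 * (m + 2 * (\<alpha> * \<beta>)) = \<beta>\<^sup>2" using ab(1,2) by simp
  then have "c * sqrt (m + 2 * (\<alpha> * \<beta>)) = \<beta>"
    using c ab(2) by (metis real_sqrt_mult real_sqrt_unique less_imp_le real_sqrt_abs abs_of_pos)
  moreover have "0 < sqrt (m + 2 * (\<alpha> * \<beta>))" using m ab(1,2) by (simp add: add_nonneg_pos)
  ultimately have "c = \<beta> / sqrt (m + 2 * (\<alpha> * \<beta>))" by (simp add: field_simps)
  then show "geom_mean_pd A B = geom_mean_formula A B"
    using ab(2) by (simp add: geom_mean_formula_def Let_def G Gc r m_def scaleR_add_right flip: \<alpha>_def \<beta>_def)
  show "Re (det (geom_mean_pd A B)) = \<alpha> * \<beta>" by (simp add: G detG)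
  show "pos_semidef (geom_mean_pd A B)"
    using pos_semidef_congruence[OF S(2), of R] by (simp add: G G_def hR)
  have collect: "U - V - (V - W) = U - 2 *\<^sub>R V + W" for U V W :: "complex^2^2"
    by (simp add: vec_eq_iff complex_eq_iff)
  have "(S - mat 1) ** (S - mat 1) = S ** S - 2 *\<^sub>R S + mat 1"
    by (simp only: matrix_mult_distrib matrix_mul_lid matrix_mul_rid collect)
  moreover have "adj ((S - mat 1) ** R) ** ((S - mat 1) ** R) = R ** ((S - mat 1) ** (S - mat 1)) ** R"
    by (simp add: adj_matrix_mult adj_diff hS hR matrix_mul_assoc)
  ultimately have "adj ((S - mat 1) ** R) ** ((S - mat 1) ** R) = R ** (S ** S - 2 *\<^sub>R S + mat 1) ** R"
    by simp
  also have "\<dots> = A + B - 2 *\<^sub>R G"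
    unfolding S(3) matrix_mult_distrib matrix_mult_scaleR_left matrix_mult_scaleR_right RCR
    by (simp add: R G_def)
  finally show "pos_semidef (A + B - 2 *\<^sub>R geom_mean_pd A B)"
    using pos_semidef_adj_mult[of "(S - mat 1) ** R"] by (simp add: G)
qed

section \<open>The geometric mean of positive semidefinite matrices\<close>

text \<open>
  The delicate case: the formula tends to \<open>0 / 0\<close>.  If both determinants vanish, numerator and
  denominator contain the common factor \<open>sqrt \<epsilon>\<close>, and the denominator becomes
  \<open>sqrt (tr A + \<epsilon>) + sqrt (tr B + \<epsilon>)\<close> after cancelling it.  If \<open>B\<close> is definite, then \<open>A = 0\<close> and the
  whole expression is \<open>sqrt \<epsilon>\<close> times a convergent one.
\<close>

lemma geom_mean_formula_converges_singular:
  assumes A: "pos_semidef A" and B: "pos_semidef B"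
    and dA: "Re (det A) = 0" and m: "mixed_det A B = 0"
  shows "\<exists>G. ((\<lambda>\<epsilon>. geom_mean_formula (A + \<epsilon> *\<^sub>R mat 1) (B + \<epsilon> *\<^sub>R mat 1)) \<longlongrightarrow> G) (at_right 0)"
proof -
  define a where "a = Re (trace A)"
  define b where "b = Re (trace B)"
  define d where "d = Re (det B)"
  have nn: "0 \<le> a" "0 \<le> b" "0 \<le> d"
    using A B by (simp_all add: a_def b_def d_def pos_semidef_2_iff)
  have formula: "geom_mean_formula (A + \<epsilon> *\<^sub>R mat 1) (B + \<epsilon> *\<^sub>R mat 1) =
      (let \<alpha> = sqrt (\<epsilon> * (a + \<epsilon>)); \<beta> = sqrt (d + \<epsilon> * (b + \<epsilon>));
           s = sqrt (\<epsilon> * (a + b + 2 * \<epsilon>) + 2 * (\<alpha> * \<beta>))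
       in (\<beta> / s) *\<^sub>R (A + \<epsilon> *\<^sub>R mat 1) + (\<alpha> / s) *\<^sub>R (B + \<epsilon> *\<^sub>R mat 1))" for \<epsilon>
  proof -
    have "Re (det (A + \<epsilon> *\<^sub>R mat 1)) = \<epsilon> * (a + \<epsilon>)"
      "Re (det (B + \<epsilon> *\<^sub>R mat 1)) = d + \<epsilon> * (b + \<epsilon>)"
      "mixed_det (A + \<epsilon> *\<^sub>R mat 1) (B + \<epsilon> *\<^sub>R mat 1) = \<epsilon> * (a + b + 2 * \<epsilon>)"
      unfolding Re_det_shift mixed_det_shift dA m a_def b_def d_def
      by (simp_all add: algebra_simps power2_eq_square)
    then show ?thesis by (simp only: geom_mean_formula_def)
  qed
  have pos: "\<forall>\<^sub>F \<epsilon> in at_right (0 :: real). 0 < \<epsilon>" by (simp add: eventually_at_right_less)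
  show ?thesis
  proof (cases "d = 0")
    case True
    define w where "w \<epsilon> = sqrt (a + \<epsilon>) + sqrt (b + \<epsilon>)" for \<epsilon>
    define F where "F \<epsilon> = (sqrt (b + \<epsilon>) / w \<epsilon>) *\<^sub>R (A + \<epsilon> *\<^sub>R mat 1)
        + (sqrt (a + \<epsilon>) / w \<epsilon>) *\<^sub>R (B + \<epsilon> *\<^sub>R mat 1)" for \<epsilon>
    have eq: "F \<epsilon> = geom_mean_formula (A + \<epsilon> *\<^sub>R mat 1) (B + \<epsilon> *\<^sub>R mat 1)" if "0 < \<epsilon>" for \<epsilon>
    proof -
      have "sqrt (\<epsilon> * (a + \<epsilon>)) * sqrt (\<epsilon> * (b + \<epsilon>))
          = (sqrt \<epsilon> * sqrt \<epsilon>) * (sqrt (a + \<epsilon>) * sqrt (b + \<epsilon>))"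
        by (simp only: real_sqrt_mult mult_ac)
      moreover have "(w \<epsilon>)\<^sup>2 = a + b + 2 * \<epsilon> + 2 * (sqrt (a + \<epsilon>) * sqrt (b + \<epsilon>))"
        using that nn by (simp add: w_def power2_sum)
      ultimately have "\<epsilon> * (a + b + 2 * \<epsilon>) + 2 * (sqrt (\<epsilon> * (a + \<epsilon>)) * sqrt (\<epsilon> * (b + \<epsilon>)))
          = \<epsilon> * (w \<epsilon>)\<^sup>2"
        using that by (simp add: distrib_left)
      moreover have "0 < w \<epsilon>" using that nn by (simp add: w_def add_nonneg_pos)
      ultimately have s: "sqrt (\<epsilon> * (a + b + 2 * \<epsilon>)
          + 2 * (sqrt (\<epsilon> * (a + \<epsilon>)) * sqrt (\<epsilon> * (b + \<epsilon>)))) = sqrt \<epsilon> * w \<epsilon>"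
        by (simp add: real_sqrt_mult)
      have "sqrt (\<epsilon> * x) / (sqrt \<epsilon> * w \<epsilon>) = sqrt x / w \<epsilon>" for x
        using that by (simp add: real_sqrt_mult)
      then show ?thesis
        unfolding formula F_def Let_def True add_0_left s by simp
    qed
    have "\<exists>p q. ((\<lambda>\<epsilon>. sqrt (b + \<epsilon>) / w \<epsilon>) \<longlongrightarrow> p) (at_right 0)
        \<and> ((\<lambda>\<epsilon>. sqrt (a + \<epsilon>) / w \<epsilon>) \<longlongrightarrow> q) (at_right 0)"
    \<comment> \<open>If both traces vanish, the two quotients equal \<open>1 / 2\<close> although \<open>w\<close> tends to 0.\<close>
    proof (cases "a + b = 0")
      case True
      with nn have "a = 0" "b = 0" by auto
      then have "\<forall>\<^sub>F \<epsilon> in at_right 0. sqrt (b + \<epsilon>) / w \<epsilon> = 1 / 2"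
         "\<forall>\<^sub>F \<epsilon> in at_right 0. sqrt (a + \<epsilon>) / w \<epsilon> = 1 / 2"
        by (auto intro!: eventually_mono[OF pos] simp: w_def)
      then show ?thesis by (blast intro: tendsto_eventually)
    next
      case False
      with nn have "w 0 \<noteq> 0" by (auto simp: w_def add_nonneg_eq_0_iff)
      then have "((\<lambda>\<epsilon>. sqrt (b + \<epsilon>) / w \<epsilon>) \<longlongrightarrow> sqrt (b + 0) / w 0) (at_right 0)"
        "((\<lambda>\<epsilon>. sqrt (a + \<epsilon>) / w \<epsilon>) \<longlongrightarrow> sqrt (a + 0) / w 0) (at_right 0)"
        unfolding w_def by (intro tendsto_intros; simp)+
      then show ?thesis by blast
    qed
    then obtain p q where "((\<lambda>\<epsilon>. sqrt (b + \<epsilon>) / w \<epsilon>) \<longlongrightarrow> p) (at_right 0)"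
        "((\<lambda>\<epsilon>. sqrt (a + \<epsilon>) / w \<epsilon>) \<longlongrightarrow> q) (at_right 0)" by blast
    then have "(F \<longlongrightarrow> p *\<^sub>R (A + 0 *\<^sub>R mat 1) + q *\<^sub>R (B + 0 *\<^sub>R mat 1)) (at_right 0)"
      unfolding F_def by (intro tendsto_intros)
    then have "((\<lambda>\<epsilon>. geom_mean_formula (A + \<epsilon> *\<^sub>R mat 1) (B + \<epsilon> *\<^sub>R mat 1)) \<longlongrightarrow>
        p *\<^sub>R (A + 0 *\<^sub>R mat 1) + q *\<^sub>R (B + 0 *\<^sub>R mat 1)) (at_right 0)"
      by (rule Lim_transform_eventually) (auto intro!: eventually_mono[OF pos] eq)
    then show ?thesis by blast
  next
    case False
    with nn have d: "0 < d" by simp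
    then have A0: "A = 0" using mixed_det_eq_0_imp_eq_0[OF A B dA _ m] by (simp add: d_def)
    then have a0: "a = 0" by (simp add: a_def trace_2)
    define \<beta> where "\<beta> \<epsilon> = sqrt (d + \<epsilon> * (b + \<epsilon>))" for \<epsilon>
    define w where "w \<epsilon> = sqrt (b + 2 * \<epsilon> + 2 * \<beta> \<epsilon>)" for \<epsilon>
    define F where "F \<epsilon> = (sqrt \<epsilon> * \<beta> \<epsilon> / w \<epsilon>) *\<^sub>R mat 1
        + (sqrt \<epsilon> / w \<epsilon>) *\<^sub>R (B + \<epsilon> *\<^sub>R mat 1)" for \<epsilon>
    have eq: "F \<epsilon> = geom_mean_formula (A + \<epsilon> *\<^sub>R mat 1) (B + \<epsilon> *\<^sub>R mat 1)" if "0 < \<epsilon>" for \<epsilon>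
    proof -
      have s: "sqrt (\<epsilon> * (b + 2 * \<epsilon>) + 2 * (\<epsilon> * \<beta> \<epsilon>)) = sqrt \<epsilon> * w \<epsilon>"
        unfolding w_def real_sqrt_mult[symmetric] by (simp add: algebra_simps)
      have \<alpha>: "sqrt (\<epsilon> * \<epsilon>) = \<epsilon>" using that by simp
      have "\<epsilon> * x / (sqrt \<epsilon> * y) = (\<epsilon> / sqrt \<epsilon>) * x / y" for x y by simp
      then have q: "\<epsilon> * x / (sqrt \<epsilon> * y) = sqrt \<epsilon> * x / y" for x y
        using that by (simp add: real_div_sqrt)
      have c1: "\<beta> \<epsilon> / (sqrt \<epsilon> * w \<epsilon>) * \<epsilon> = sqrt \<epsilon> * \<beta> \<epsilon> / w \<epsilon>"
        using q[of "\<beta> \<epsilon>" "w \<epsilon>"] by (simp add: mult.commute)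
      have c2: "\<epsilon> / (sqrt \<epsilon> * w \<epsilon>) = sqrt \<epsilon> / w \<epsilon>"
        using q[of 1 "w \<epsilon>"] by simp
      show ?thesis
        unfolding formula Let_def F_def
        unfolding A0 a0 add_0_left \<alpha>
        unfolding \<beta>_def[symmetric]
        unfolding s scaleR_scaleR c1 c2 ..
    qed
    have "0 < \<beta> 0" using d by (simp add: \<beta>_def)
    then have "w 0 \<noteq> 0" using nn by (simp add: w_def)
    then have "(F \<longlongrightarrow> (sqrt 0 * \<beta> 0 / w 0) *\<^sub>R mat 1 + (sqrt 0 / w 0) *\<^sub>R (B + 0 *\<^sub>R mat 1)) (at_right 0)"
      unfolding F_def w_def \<beta>_def by (intro tendsto_intros; simp)
    then have "((\<lambda>\<epsilon>. geom_mean_formula (A + \<epsilon> *\<^sub>R mat 1) (B + \<epsilon> *\<^sub>R mat 1)) \<longlongrightarrow>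
        (sqrt 0 * \<beta> 0 / w 0) *\<^sub>R mat 1 + (sqrt 0 / w 0) *\<^sub>R (B + 0 *\<^sub>R mat 1)) (at_right 0)"
      by (rule Lim_transform_eventually) (auto intro!: eventually_mono[OF pos] eq)
    then show ?thesis by blast
  qed
qed

lemma geom_mean_formula_converges:
  assumes A: "pos_semidef A" and B: "pos_semidef B"
  shows "\<exists>G. ((\<lambda>\<epsilon>. geom_mean_formula (A + \<epsilon> *\<^sub>R mat 1) (B + \<epsilon> *\<^sub>R mat 1)) \<longlongrightarrow> G) (at_right 0)"
proof (cases "mixed_det A B = 0 \<and> (Re (det A) = 0 \<or> Re (det B) = 0)")
  case True
  then consider "Re (det A) = 0" "mixed_det A B = 0" | "Re (det B) = 0" "mixed_det B A = 0"
    using mixed_det_commute[of A B] by auto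
  then show ?thesis
  proof cases
    case 1
    then show ?thesis by (rule geom_mean_formula_converges_singular[OF A B])
  next
    case 2
    then show ?thesis
      by (subst geom_mean_formula_commute) (rule geom_mean_formula_converges_singular[OF B A])
  qed
next
  case False
  define \<alpha> where "\<alpha> \<epsilon> = sqrt (Re (det A) + \<epsilon> * Re (trace A) + \<epsilon>\<^sup>2)" for \<epsilon>
  define \<beta> where "\<beta> \<epsilon> = sqrt (Re (det B) + \<epsilon> * Re (trace B) + \<epsilon>\<^sup>2)" for \<epsilon>
  define s where "s \<epsilon> = sqrt (mixed_det A B + \<epsilon> * (Re (trace A) + Re (trace B)) + 2 * \<epsilon>\<^sup>2
      + 2 * (\<alpha> \<epsilon> * \<beta> \<epsilon>))" for \<epsilon>
  have dets: "0 \<le> Re (det A)" "0 \<le> Re (det B)" using A B by (simp_all add: pos_semidef_2_iff)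
  then have "0 \<le> \<alpha> 0 * \<beta> 0" by (simp add: \<alpha>_def \<beta>_def)
  with False have "s 0 \<noteq> 0"
    using mixed_det_nonneg[OF A B] by (auto simp: s_def \<alpha>_def \<beta>_def add_nonneg_eq_0_iff)
  then have "((\<lambda>\<epsilon>. (\<beta> \<epsilon> / s \<epsilon>) *\<^sub>R (A + \<epsilon> *\<^sub>R mat 1) + (\<alpha> \<epsilon> / s \<epsilon>) *\<^sub>R (B + \<epsilon> *\<^sub>R mat 1)) \<longlongrightarrow>
      (\<beta> 0 / s 0) *\<^sub>R (A + 0 *\<^sub>R mat 1) + (\<alpha> 0 / s 0) *\<^sub>R (B + 0 *\<^sub>R mat 1)) (at_right 0)"
    unfolding s_def \<alpha>_def \<beta>_def by (intro tendsto_intros; simp)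
  then show ?thesis
    unfolding geom_mean_formula_def Let_def Re_det_shift mixed_det_shift s_def \<alpha>_def \<beta>_def by blast
qed

text \<open>
  Each of the three statements holds for the perturbed matrices and is preserved by the limit.
\<close>

lemma geom_mean_2:
  fixes A B :: "complex^2^2"
  assumes A: "pos_semidef A" and B: "pos_semidef B"
  shows "pos_semidef (geom_mean A B)"
    and "Re (det (geom_mean A B)) = sqrt (Re (det A) * Re (det B))"
    and "pos_semidef (A + B - 2 *\<^sub>R geom_mean A B)"
proof -
  define F where "F \<epsilon> = geom_mean_pd (A + \<epsilon> *\<^sub>R mat 1) (B + \<epsilon> *\<^sub>R mat 1)" for \<epsilon> :: real
  have pos: "\<forall>\<^sub>F \<epsilon> in at_right (0 :: real). 0 < \<epsilon>" by (simp add: eventually_at_right_less)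
  have pd: "F \<epsilon> = geom_mean_formula (A + \<epsilon> *\<^sub>R mat 1) (B + \<epsilon> *\<^sub>R mat 1)"
    "Re (det (F \<epsilon>)) = sqrt (Re (det (A + \<epsilon> *\<^sub>R mat 1))) * sqrt (Re (det (B + \<epsilon> *\<^sub>R mat 1)))"
    "pos_semidef (F \<epsilon>)"
    "pos_semidef ((A + \<epsilon> *\<^sub>R mat 1) + (B + \<epsilon> *\<^sub>R mat 1) - 2 *\<^sub>R F \<epsilon>)"
    if "0 < \<epsilon>" for \<epsilon>
    unfolding F_def
    by (intro geom_mean_pd_2 pos_semidef_shift Re_det_shift_pos A B that less_imp_le[OF that])+
  then have "\<forall>\<^sub>F \<epsilon> in at_right 0. geom_mean_formula (A + \<epsilon> *\<^sub>R mat 1) (B + \<epsilon> *\<^sub>R mat 1) = F \<epsilon>"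
    by (auto intro!: eventually_mono[OF pos] simp: pd(1))
  with geom_mean_formula_converges[OF A B] obtain G where G: "(F \<longlongrightarrow> G) (at_right 0)"
    using Lim_transform_eventually by blast
  have gm: "geom_mean A B = G"
    unfolding geom_mean_def F_def[symmetric] by (rule tendsto_Lim) (simp_all add: G)
  show "pos_semidef (geom_mean A B)"
    unfolding gm by (rule pos_semidef_limit[OF G]) (auto intro!: eventually_mono[OF pos] pd(3))
  have "((\<lambda>\<epsilon>. (A + \<epsilon> *\<^sub>R mat 1) + (B + \<epsilon> *\<^sub>R mat 1) - 2 *\<^sub>R F \<epsilon>) \<longlongrightarrow>
      (A + 0 *\<^sub>R mat 1) + (B + 0 *\<^sub>R mat 1) - 2 *\<^sub>R G) (at_right 0)"
    by (intro tendsto_intros G)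
  then have "pos_semidef ((A + 0 *\<^sub>R mat 1) + (B + 0 *\<^sub>R mat 1) - 2 *\<^sub>R G)"
    by (rule pos_semidef_limit) (rule eventually_mono[OF pos pd(4)], simp_all)
  then show "pos_semidef (A + B - 2 *\<^sub>R geom_mean A B)" by (simp add: gm)
  have "((\<lambda>\<epsilon>. sqrt (Re (det A) + \<epsilon> * Re (trace A) + \<epsilon>\<^sup>2) * sqrt (Re (det B) + \<epsilon> * Re (trace B) + \<epsilon>\<^sup>2))
      \<longlongrightarrow> sqrt (Re (det A) + 0 * Re (trace A) + 0\<^sup>2) * sqrt (Re (det B) + 0 * Re (trace B) + 0\<^sup>2)) (at_right 0)"
    by (intro tendsto_intros)
  moreover have "\<forall>\<^sub>F \<epsilon> in at_right 0. sqrt (Re (det A) + \<epsilon> * Re (trace A) + \<epsilon>\<^sup>2)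
      * sqrt (Re (det B) + \<epsilon> * Re (trace B) + \<epsilon>\<^sup>2) = Re (det (F \<epsilon>))"
    by (auto intro!: eventually_mono[OF pos] simp: pd(2) Re_det_shift)
  ultimately have "((\<lambda>\<epsilon>. Re (det (F \<epsilon>)))
      \<longlongrightarrow> sqrt (Re (det A) + 0 * Re (trace A) + 0\<^sup>2) * sqrt (Re (det B) + 0 * Re (trace B) + 0\<^sup>2)) (at_right 0)"
    by (rule Lim_transform_eventually)
  moreover have "((\<lambda>\<epsilon>. Re (det (F \<epsilon>))) \<longlongrightarrow> Re (det G)) (at_right 0)"
    unfolding det_2 by (intro tendsto_intros G)
  ultimately have "Re (det G) = sqrt (Re (det A) + 0 * Re (trace A) + 0\<^sup>2)
      * sqrt (Re (det B) + 0 * Re (trace B) + 0\<^sup>2)"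
    by (rule tendsto_unique[OF trivial_limit_at_right_real, rotated])
  then show "Re (det (geom_mean A B)) = sqrt (Re (det A) * Re (det B))"
    by (simp add: gm real_sqrt_mult)
qed

section \<open>Positive semidefinite block matrices\<close>

lemma hermitian_blocks:
  assumes "hermitian M"
  shows "hermitian (block11 M)" "hermitian (block22 M)" "M $ Inr i $ Inl j = adj (block12 M) $ i $ j"
proof -
  have *: "cnj (M $ q $ p) = M $ p $ q" for p q
  proof -
    have "cnj (M $ q $ p) = adj M $ p $ q" by (simp add: adj_def)
    with assms show ?thesis by (simp only: hermitian_def)
  qed
  show "hermitian (block11 M)" "hermitian (block22 M)" "M $ Inr i $ Inl j = adj (block12 M) $ i $ j"
    by (simp_all add: hermitian_def adj_def block11_def block22_def block12_def vec_eq_iff *)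
qed

lemma sum_UNIV_sum:
  fixes f :: "'a::finite + 'b::finite \<Rightarrow> 'c::comm_monoid_add"
  shows "sum f UNIV = (\<Sum>i\<in>UNIV. f (Inl i)) + (\<Sum>i\<in>UNIV. f (Inr i))"
  by (simp add: sum.Plus flip: UNIV_Plus_UNIV)

lemma pos_semidef_block_form:
  fixes M :: "complex^('n::finite + 'n)^('n + 'n)"
  assumes "pos_semidef M"
  shows "0 \<le> Re (cinner x (block11 M *v x)) + 2 * Re (cinner x (block12 M *v y))
            + Re (cinner y (block22 M *v y))"
proof -
  have h: "hermitian M" using assms by (simp add: pos_semidef_def)
  define z where "z = (\<chi> k. case k of Inl i \<Rightarrow> x $ i | Inr i \<Rightarrow> y $ i)"
  have z: "z $ Inl i = x $ i" "z $ Inr i = y $ i" for i by (simp_all add: z_def)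
  have Mz1: "(M *v z) $ Inl i = (block11 M *v x) $ i + (block12 M *v y) $ i" for i
    by (simp add: matrix_vector_mult_def sum_UNIV_sum z block11_def block12_def)
  have Mz2: "(M *v z) $ Inr i = (adj (block12 M) *v x) $ i + (block22 M *v y) $ i" for i
    by (simp add: matrix_vector_mult_def sum_UNIV_sum z block22_def hermitian_blocks(3)[OF h])
  have "cinner z (M *v z) = cinner x (block11 M *v x) + cinner x (block12 M *v y)
      + cinner y (adj (block12 M) *v x) + cinner y (block22 M *v y)"
    unfolding cinner_def sum_UNIV_sum z Mz1 Mz2 by (simp only: distrib_left sum.distrib add.assoc)
  also have "cinner y (adj (block12 M) *v x) = cnj (cinner x (block12 M *v y))"
    by (subst cinner_adj, subst cinner_commute) simp
  finally have "Re (cinner z (M *v z)) = Re (cinner x (block11 M *v x)) + 2 * Re (cinner x (block12 M *v y))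
            + Re (cinner y (block22 M *v y))" by simp
  then show ?thesis using assms by (metis pos_semidef_def)
qed

lemma pos_semidef_blocks:
  fixes M :: "complex^('n::finite + 'n)^('n + 'n)"
  assumes "pos_semidef M"
  shows "pos_semidef (block11 M)" "pos_semidef (block22 M)"
  using pos_semidef_block_form[OF assms, of _ 0] pos_semidef_block_form[OF assms, of 0]
    hermitian_blocks(1,2)[OF pos_semidef_hermitian[OF assms]]
  by (simp_all add: pos_semidef_def)

text \<open>
  For definite \<open>A\<close>, the quadratic form of \<open>M\<close> at \<open>(- A\<^sup>-\<^sup>1 X y, y)\<close> is that of the Schur complement
  \<open>B - X\<^sup>* A\<^sup>-\<^sup>1 X\<close>, which is therefore positive semidefinite; monotonicity of the determinant gives
  \<open>\<bar>det X\<bar>\<^sup>2 / det A \<le> det B\<close>.  In general \<open>A\<close> is perturbed to \<open>A + \<epsilon> I\<close>.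
\<close>

lemma det_block12_le:
  fixes M :: "complex^(2 + 2)^(2 + 2)"
  assumes M: "pos_semidef M"
  shows "(cmod (det (block12 M)))\<^sup>2 \<le> Re (det (block11 M)) * Re (det (block22 M))"
proof -
  define A X B where "A = block11 M" and "X = block12 M" and "B = block22 M"
  have A: "pos_semidef A" and B: "pos_semidef B"
    using pos_semidef_blocks[OF M] by (simp_all add: A_def B_def)
  have le: "(cmod (det X))\<^sup>2 \<le> (Re (det A) + \<epsilon> * Re (trace A) + \<epsilon>\<^sup>2) * Re (det B)" if "0 < \<epsilon>" for \<epsilon>
  proof -
    define A' where "A' = A + \<epsilon> *\<^sub>R mat 1"
    have A': "pos_semidef A'" and dA': "0 < Re (det A')"
      using A that by (simp_all add: A'_def pos_semidef_shift Re_det_shift_pos)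
    then have "det A' \<noteq> 0" by auto
    then have inv: "invertible A'" by (simp add: invertible_det_nz)
    define W where "W = matrix_inv A' ** X"
    have AW: "A' ** W = X"
      by (simp add: W_def matrix_mul_assoc matrix_inv_mult[OF inv])
    define C where "C = adj W ** X"
    have C: "pos_semidef C"
      using pos_semidef_congruence[OF A', of W] by (simp add: C_def AW flip: matrix_mul_assoc)
    have "0 \<le> Re (cinner y ((B - C) *v y))" for y
    proof -
      \<comment> \<open>The minimizer over \<open>x\<close> of the form of the perturbed \<open>M\<close> at \<open>(x, y)\<close>.\<close>
      define x where "x = - (W *v y)"
      have minus: "A *v (- u) = - (A *v u)" for u
        by (simp add: vec_eq_iff matrix_vector_mult_def sum_negf)
      have "cinner x (A *v x) = cinner (W *v y) (A *v (W *v y))"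
        by (simp add: x_def cinner_minus_left cinner_minus_right minus)
      moreover have "A' *v (W *v y) = A *v (W *v y) + \<epsilon> *\<^sub>R (W *v y)"
        by (simp add: A'_def matrix_vector_mult_add_rdistrib matrix_vector_mult_scaleR_left)
      moreover have "A' *v (W *v y) = X *v y" by (simp add: matrix_vector_mul_assoc AW)
      moreover have "0 \<le> Re (cinner (W *v y) (W *v y))" by (simp add: cinner_self sum_nonneg)
      ultimately have 1: "Re (cinner x (A *v x)) \<le> Re (cinner (W *v y) (X *v y))"
        using that by (simp add: cinner_add_right cinner_scaleR_right)
      have 2: "cinner x (X *v y) = - cinner (W *v y) (X *v y)"
        by (simp add: x_def cinner_minus_left)
      have 3: "cinner y (C *v y) = cinner (W *v y) (X *v y)"
        by (simp add: C_def cinner_adj flip: matrix_vector_mul_assoc)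
      have "cinner y ((B - C) *v y) = cinner y (B *v y) - cinner y (C *v y)"
        by (simp add: matrix_vector_mult_diff_rdistrib cinner_def algebra_simps sum_subtractf)
      then show ?thesis
        using 1 2 3 pos_semidef_block_form[OF M, of x y] by (simp add: A_def X_def B_def)
    qed
    moreover have "hermitian (B - C)"
      using B C by (simp add: pos_semidef_def hermitian_def adj_diff)
    ultimately have "pos_semidef (B - C)" by (simp add: pos_semidef_def)
    then have mono: "Re (det C) \<le> Re (det B)" using C by (intro Re_det_mono)
    have "det C = cnj (det W) * det X" by (simp add: C_def det_mul det_adj_2)
    moreover have "det X = det A' * det W" by (simp flip: AW add: det_mul)
    moreover have "Im (det A') = 0" using A' by (simp add: Re_det_2(2) pos_semidef_hermitian)
    then have "cnj (det A') = det A'" by (simp add: complex_eq_iff)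
    ultimately have "det A' * det C = cnj (det X) * det X" by simp
    also have "\<dots> = of_real ((cmod (det X))\<^sup>2)" 
      by (simp add: complex_norm_square mult.commute flip: of_real_power)
    finally have "Re (det A' * det C) = (cmod (det X))\<^sup>2"
      by (simp only: Re_complex_of_real)
    then have "Re (det A') * Re (det C) = (cmod (det X))\<^sup>2"
      using \<open>Im (det A') = 0\<close> by simp
    then show ?thesis
      using mult_left_mono[OF mono, of "Re (det A')"] dA' by (simp add: A'_def Re_det_shift)
  qed
  have "((\<lambda>\<epsilon>. (Re (det A) + \<epsilon> * Re (trace A) + \<epsilon>\<^sup>2) * Re (det B))
      \<longlongrightarrow> (Re (det A) + 0 * Re (trace A) + 0\<^sup>2) * Re (det B)) (at_right 0)"
    by (intro tendsto_intros)
  then have "(cmod (det X))\<^sup>2 \<le> (Re (det A) + 0 * Re (trace A) + 0\<^sup>2) * Re (det B)"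
    by (rule tendsto_lowerbound)
      (auto intro!: le eventually_mono[OF eventually_at_right_less])
  then show ?thesis by (simp add: A_def X_def B_def)
qed

section \<open>The la-property implies the a-property or the lg-property\<close>

theorem proposition2p1:
  fixes M :: "complex^(2 + 2)^(2 + 2)"
  assumes "pos_semidef M"
    and "la_property M"
  shows "a_property M \<or> lg_property M"
proof -
  define A X B where "A = block11 M" and "X = block12 M" and "B = block22 M"
  define G where "G = geom_mean A B"
  have A: "pos_semidef A" and B: "pos_semidef B"
    using pos_semidef_blocks[OF assms(1)] by (simp_all add: A_def B_def)
  have AB: "pos_semidef (A + B)" using A B by (rule pos_semidef_add)
  note G = geom_mean_2[OF A B, folded G_def]
  have hG: "hermitian G" and hAB: "hermitian (A + B)"
    using G(1) AB by (simp_all add: pos_semidef_hermitian)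
  have indices: "{1..CARD(2)} = {1, 2}" and upto_2: "{Suc 0..2} = {Suc 0, 2}" by auto
  note s = singval_2[of X]
  have "sqrt ((cmod (det X))\<^sup>2) \<le> sqrt (Re (det A) * Re (det B))"
    using det_block12_le[OF assms(1)] by (intro real_sqrt_le_mono) (simp add: A_def X_def B_def)
  then have prod: "singval X 1 * singval X 2 \<le> eigval G 1 * eigval G 2"
    unfolding s(3) eigval_2_prod[OF hG] G(2) by simp
  have am_gm: "2 * eigval G 2 \<le> eigval (A + B) 2"
  proof (rule le_eigval_2[OF hAB])
    have "pos_semidef ((A + B - 2 *\<^sub>R G) + 2 *\<^sub>R (G - eigval G 2 *\<^sub>R mat 1))"
      by (intro pos_semidef_add pos_semidef_scaleR G(3) pos_semidef_minus_eigval_2 hG) simp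
    moreover have "(A + B - 2 *\<^sub>R G) + 2 *\<^sub>R (G - eigval G 2 *\<^sub>R mat 1)
        = A + B - (2 * eigval G 2) *\<^sub>R mat 1"
      by (simp add: scaleR_diff_right)
    ultimately show "pos_semidef (A + B - (2 * eigval G 2) *\<^sub>R mat 1)"
      by (simp only:)
  qed
  have eG: "0 \<le> eigval G 2" "eigval G 2 \<le> eigval G 1"
    using le_eigval_2[OF hG, of 0] G(1) eigval_2_antimono[OF hG] by simp_all
  have la: "2 * singval X 1 \<le> eigval (A + B) 1"
    using assms(2) unfolding la_property_def indices by (simp add: A_def B_def X_def)
  show ?thesis
  proof (cases "2 * singval X 2 \<le> eigval (A + B) 2")
    case True
    with la have "a_property M"
      unfolding a_property_def indices by (simp add: A_def B_def X_def)
    then show ?thesis ..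
  next
    case False
    with am_gm have less: "eigval G 2 < singval X 2" by simp
    have "eigval G 1 * eigval G 2 \<le> eigval G 1 * singval X 2"
      using less eG by (intro mult_left_mono) auto
    with prod have "singval X 1 * singval X 2 \<le> eigval G 1 * singval X 2" by simp
    then have "singval X 1 \<le> eigval G 1" using less eG(1) by simp
    with prod have "lg_property M"
      unfolding lg_property_def indices by (simp add: upto_2 A_def B_def X_def G_def)
    then show ?thesis ..
  qed
qed

end
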